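(* Let $\sigma>1$. Let $(\alpha_n)_{n\in\mathbb N_0}$ and $(\beta_m)_{m\in\mathbb N_0}$ be strictly increasing sequences of non-negative integers (hence tending to infinity) with $\alpha_0=\beta_0=0$, and suppose there is $L>1$ such that $$\frac{\alpha_{n+1}}{\alpha_n}\le L\quad\text{and}\quad \frac{\beta_{n+1}}{\beta_n}\le L\qquad\text{for all } n\in\mathbb N=\{1,2,\dots\}.$$ Suppose that $\varphi\in C^\infty(\mathbb R)$ and that there are $\tau_0>0$ and $C_0>0$ such that $$\sup_{x\in\mathbb R}|x^{\alpha_n}\varphi^{(\beta_m)}(x)|\le C_0\,M_{\alpha_n}^{\tau_0,\sigma}M_{\beta_m}^{\tau_0,\sigma},\qquad m,n\in\mathbb N_0 .$$ Then $\varphi\in\mathcal S_{\{\mathcal M_\sigma\}}^{\{\mathcal M_\sigma\}}(\mathbb R)$.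
   Context: $\mathbb N_0=\{0,1,2,\dots\}$. For $\tau>0$, $\sigma>1$ put $M_0^{\tau,\sigma}=1$ and $M_n^{\tau,\sigma}=n^{\tau n^\sigma}$ for integers $n\ge1$; $\mathcal M_\sigma=\{(M_n^{\tau,\sigma})_{n\in\mathbb N_0}:\tau>0\}$. The extended Gelfand--Shilov space of Roumieu type $\mathcal S_{\{\mathcal M_\sigma\}}^{\{\mathcal M_\sigma\}}(\mathbb R)$ is the set of all $\varphi\in C^\infty(\mathbb R)$ (complex-valued) for which there exist $\tau>0$ and $C>0$ such that for all $\alpha,\beta\in\mathbb N_0$ $$\sup_{x\in\mathbb R}|x^\alpha\varphi^{(\beta)}(x)|\le C\,M_\alpha^{\tau,\sigma}M_\beta^{\tau,\sigma}.$$ *)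

theory Defs
  imports "HOL-Analysis.Analysis"
begin

definition M_seq :: "real \<Rightarrow> real \<Rightarrow> nat \<Rightarrow> real" where
  "M_seq \<tau> \<sigma> n = (if n = 0 then 1 else real n powr (\<tau> * real n powr \<sigma>))"

definition nth_deriv :: "nat \<Rightarrow> (real \<Rightarrow> complex) \<Rightarrow> real \<Rightarrow> complex" where
  "nth_deriv n \<phi> = ((\<lambda>f x. vector_derivative f (at x)) ^^ n) \<phi>"

definition smooth :: "(real \<Rightarrow> complex) \<Rightarrow> bool" where
  "smooth \<phi> \<longleftrightarrow> (\<forall>n x. nth_deriv n \<phi> differentiable (at x))"

(* The supremum is taken in the extended reals: over the type real, SUP has no
   meaningful value for an unbounded function. *)
definition GS_seminorm :: "(real \<Rightarrow> complex) \<Rightarrow> nat \<Rightarrow> nat \<Rightarrow> ereal" where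
  "GS_seminorm \<phi> \<alpha> \<beta> = (SUP x. ereal (norm (of_real x ^ \<alpha> * nth_deriv \<beta> \<phi> x)))"

(* The extended Gelfand--Shilov space of Roumieu type; the same \<tau> governs both
   the decay and the derivative bounds. *)
definition GS_Roumieu :: "real \<Rightarrow> (real \<Rightarrow> complex) set" where
  "GS_Roumieu \<sigma> = {\<phi>. smooth \<phi> \<and>
     (\<exists>\<tau>>0. \<exists>C>0. \<forall>\<alpha> \<beta>. GS_seminorm \<phi> \<alpha> \<beta> \<le> ereal (C * M_seq \<tau> \<sigma> \<alpha> * M_seq \<tau> \<sigma> \<beta>))}"

end

theory Submission
  imports Defs
begin

text \<open>The ratio condition lets every order \<open>a\<close> be rounded up to a member of the sequence of size at most
  \<open>R * a\<close>, and dilating the index changes \<open>M_seq\<close> only through a larger \<open>\<tau>\<close>. For the decay orders it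
  then suffices that \<open>\<bar>x\<bar> ^ a \<le> 1 + \<bar>x\<bar> ^ a'\<close> when \<open>a \<le> a'\<close>. A derivative of order \<open>j \<le> k\<close> is
  interpolated between the orders \<open>0\<close> and \<open>k\<close> on a half-line. Repeated use of Landau's inequality
  would cost a factor \<open>c ^ (k\<^sup>2)\<close>, too much for \<open>\<sigma> < 2\<close>; comparing \<open>j\<close>-th derivatives with \<open>j\<close>-th
  finite differences of step \<open>1 / j\<close> costs only \<open>k * (2 * k) ^ k\<close>.\<close>

section \<open>Interpolation between derivatives on a half-line\<close>

lemma norm_diff_le_of_vector_derivative:
  fixes f :: "real \<Rightarrow> 'a::real_normed_vector"
  assumes "a \<le> b"
    and f': "\<And>x. (f has_vector_derivative f' x) (at x)"
    and bound: "\<And>x. a \<le> x \<Longrightarrow> norm (f' x) \<le> K"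
  shows "norm (f b - f a) \<le> (b - a) * K"
proof (cases "a = b")
  case False
  have "continuous_on {a..b} f"
    using f' by (meson continuous_at_imp_continuous_on has_vector_derivative_continuous)
  moreover have "((\<lambda>x. x * K) has_vector_derivative K) (at x)" for x
    by (auto intro!: derivative_eq_intros simp flip: has_real_derivative_iff_has_vector_derivative)
  ultimately have "norm (f b - f a) \<le> b * K - a * K"
    using False assms
    by (intro differentiable_bound_general[where f' = f' and \<phi>' = "\<lambda>_. K"])
      (auto intro!: continuous_intros)
  then show ?thesis
    by (simp add: algebra_simps)
qed simp

text \<open>The induction replaces \<open>g i\<close> by its increments \<open>g i (t + h) - g i t\<close>, which trade the bounds
  \<open>A\<close>, \<open>K\<close> for \<open>2 * A\<close>, \<open>h * K\<close>; after \<open>j\<close> steps this is the \<open>j\<close>-th finite difference of \<open>g 0\<close>.\<close>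

lemma intermediate_derivative_step:
  fixes g :: "nat \<Rightarrow> real \<Rightarrow> 'a::real_normed_vector"
  assumes "h > 0"
    and "\<And>i t. (g i has_vector_derivative g (Suc i) t) (at t)"
    and "\<And>t. t \<ge> x \<Longrightarrow> norm (g 0 t) \<le> A"
    and "\<And>t. t \<ge> x \<Longrightarrow> norm (g (Suc j) t) \<le> K"
    and "t \<ge> x"
  shows "h ^ j * norm (g j t) \<le> 2 ^ j * A + real j * h ^ Suc j * K"
  using assms(2-)
proof (induction j arbitrary: g A K t)
  case 0
  then show ?case by simp
next
  case (Suc j)
  define u where "u i s = g i (s + h) - g i s" for i s
  have u_deriv: "(u i has_vector_derivative u (Suc i) s) (at s)" for i s
  proof -
    have "((g i \<circ> (\<lambda>s. s + h)) has_vector_derivative 1 *\<^sub>R g (Suc i) (s + h)) (at s)"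
      by (rule vector_diff_chain_at) (auto intro!: derivative_eq_intros Suc.prems(1))
    then show ?thesis
      unfolding u_def comp_def by (auto intro!: derivative_eq_intros Suc.prems(1))
  qed
  have "norm (u 0 s) \<le> 2 * A" if "s \<ge> x" for s
    using norm_triangle_ineq4[of "g 0 (s + h)" "g 0 s"] Suc.prems(2)[of s] Suc.prems(2)[of "s + h"]
      that \<open>h > 0\<close> by (simp add: u_def)
  moreover have lip: "norm (g (Suc j) s' - g (Suc j) s) \<le> (s' - s) * K" if "x \<le> s" "s \<le> s'" for s s'
    using that Suc.prems by (intro norm_diff_le_of_vector_derivative) auto
  have "norm (u (Suc j) s) \<le> h * K" if "s \<ge> x" for s
    unfolding u_def using lip[of s "s + h"] that \<open>h > 0\<close> by auto
  ultimately have IH: "h ^ j * norm (u j t) \<le> 2 ^ j * (2 * A) + real j * h ^ Suc j * (h * K)"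
    by (intro Suc.IH u_deriv Suc.prems(4)) auto
  have "K \<ge> 0"
    using Suc.prems(3)[of x] norm_ge_zero order_trans by blast
  \<comment> \<open>First-order Taylor estimate recovering \<open>h *\<^sub>R g (Suc j) t\<close>
    from \<open>u j t\<close>. Its error \<open>h * (h * K)\<close> is the one extra term that turns
    the coefficient \<open>j\<close> of \<open>IH\<close> into \<open>Suc j\<close>.\<close>
  have "norm (g j (t + h) - g j t - (t + h - t) *\<^sub>R g (Suc j) t) \<le> norm (t + h - t) * (h * K)"
  proof (rule vector_differentiable_bound_linearization[where S = "{t..t + h}" and ?x0.0 = t])
    show "norm (g (Suc j) s - g (Suc j) t) \<le> h * K" if "s \<in> {t..t + h}" for s
    proof -
      have "(s - t) * K \<le> h * K"
        using that \<open>K \<ge> 0\<close> by (intro mult_right_mono) auto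
      then show ?thesis
        using lip[of t s] that Suc.prems(4) by auto
    qed
  qed (use \<open>h > 0\<close> in \<open>auto simp: closed_segment_eq_real_ivl
    intro: has_vector_derivative_at_within Suc.prems(1)\<close>)
  then have "norm (h *\<^sub>R g (Suc j) t) \<le> norm (u j t) + h * (h * K)"
    using \<open>h > 0\<close> norm_triangle_sub[of "h *\<^sub>R g (Suc j) t" "u j t"]
    by (simp add: u_def norm_minus_commute)
  then have "h ^ j * (h * norm (g (Suc j) t)) \<le> h ^ j * (norm (u j t) + h * (h * K))"
    using \<open>h > 0\<close> by (intro mult_left_mono) auto
  with IH show ?case
    by (simp add: algebra_simps)
qed

text \<open>Descend from order \<open>k\<close>. With a suitable step, order \<open>j\<close> is
  bounded by the bound for order \<open>j + 1\<close> with coefficient exactly 1, plus at most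
  \<open>(2 * k) ^ k * A\<close>. Hence \<open>B\<close> is never multiplied, and the
  \<open>k - j\<close> descents only add up.\<close>

lemma intermediate_derivative_bound:
  fixes g :: "nat \<Rightarrow> real \<Rightarrow> 'a::real_normed_vector"
  assumes deriv: "\<And>i t. (g i has_vector_derivative g (Suc i) t) (at t)"
    and A: "\<And>t. t \<ge> x \<Longrightarrow> norm (g 0 t) \<le> A"
    and B: "\<And>t. t \<ge> x \<Longrightarrow> norm (g k t) \<le> B"
    and "j \<le> k" "t \<ge> x"
  shows "norm (g j t) \<le> real (k - j) * (2 * real k) ^ k * A + B"
  using \<open>j \<le> k\<close> \<open>t \<ge> x\<close>
proof (induction j arbitrary: t rule: inc_induct)
  case base
  then show ?case using B by simp
next
  case (step j)
  have "A \<ge> 0"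
    using A[of x] norm_ge_zero order_trans by blast
  have "B \<ge> 0"
    using B[of x] norm_ge_zero order_trans by blast
  let ?K = "real (k - Suc j) * (2 * real k) ^ k * A + B"
  have "norm (g j t) \<le> (2 * real k) ^ k * A + ?K"
  proof (cases "j = 0")
    case True
    have "1 * A \<le> (2 * real k) ^ k * A"
      using \<open>j < k\<close> \<open>A \<ge> 0\<close> by (intro mult_right_mono one_le_power) auto
    moreover have "norm (g j t) \<le> A" "?K \<ge> 0"
      using True A step.prems \<open>A \<ge> 0\<close> \<open>B \<ge> 0\<close> by auto
    ultimately show ?thesis by linarith
  next
    case False
    \<comment> \<open>After division by \<open>h ^ j\<close> the coefficient of \<open>?K\<close> is
      \<open>j * h\<close>, so this step makes it 1. The case \<open>j = 0\<close> has no such step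
      and uses \<open>A\<close> directly.\<close>
    define h where "h = 1 / real j"
    have h: "h > 0" "real j * h = 1"
      using False by (auto simp: h_def)
    have "h ^ j * norm (g j t) \<le> 2 ^ j * A + real j * h ^ Suc j * ?K"
      by (rule intermediate_derivative_step) (use h deriv A step in auto)
    also have "\<dots> = h ^ j * ((2 * real j) ^ j * A + ?K)"
    proof -
      have "h * (2 * real j) = 2"
        using False by (simp add: h_def)
      then have "h ^ j * (2 * real j) ^ j = 2 ^ j"
        by (metis power_mult_distrib)
      moreover have "real j * h ^ Suc j = h ^ j"
        using h(2) by (simp add: mult.assoc[symmetric])
      ultimately show ?thesis
        by (simp only: distrib_left mult.assoc[symmetric])
    qed
    finally have "norm (g j t) \<le> (2 * real j) ^ j * A + ?K"
      using h(1) by (simp add: mult_le_cancel_left_pos)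
    moreover have "(2 * real j) ^ j \<le> (2 * real k) ^ k"
    proof -
      have "(2 * real j) ^ j \<le> (2 * real k) ^ j"
        using \<open>j < k\<close> by (intro power_mono) auto
      also have "\<dots> \<le> (2 * real k) ^ k"
        using \<open>j < k\<close> by (intro power_increasing) auto
      finally show ?thesis .
    qed
    then have "(2 * real j) ^ j * A \<le> (2 * real k) ^ k * A"
      using \<open>A \<ge> 0\<close> by (rule mult_right_mono)
    ultimately show ?thesis by linarith
  qed
  moreover have "real (k - j) = real (k - Suc j) + 1"
    using \<open>j < k\<close> by simp
  ultimately show ?case
    by (simp only: distrib_right)
qed

section \<open>Interpolation under a power weight\<close>

lemma smooth_has_vector_derivative:
  assumes "smooth \<phi>"
  shows "(nth_deriv n \<phi> has_vector_derivative nth_deriv (Suc n) \<phi> x) (at x)"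
proof -
  have "nth_deriv n \<phi> differentiable (at x)"
    using assms by (simp add: smooth_def)
  then show ?thesis
    by (simp add: vector_derivative_works nth_deriv_def)
qed

lemma GS_seminorm_le_iff:
  "GS_seminorm \<phi> a b \<le> ereal c \<longleftrightarrow> (\<forall>x. \<bar>x\<bar> ^ a * norm (nth_deriv b \<phi> x) \<le> c)"
  by (simp add: GS_seminorm_def SUP_le_iff norm_mult norm_power)

text \<open>The weight \<open>\<bar>x\<bar> ^ a\<close> can be frozen at the endpoint of the half-line pointing away from \<open>0\<close>,
  since it is smallest there; the unweighted interpolation then applies on that half-line.\<close>

lemma weighted_intermediate_derivative_bound:
  assumes "smooth \<phi>"
    and A: "\<And>x. \<bar>x\<bar> ^ a * norm (\<phi> x) \<le> A"
    and B: "\<And>x. \<bar>x\<bar> ^ a * norm (nth_deriv k \<phi> x) \<le> B"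
    and "j \<le> k"
  shows "\<bar>x\<bar> ^ a * norm (nth_deriv j \<phi> x) \<le> real k * (2 * real k) ^ k * A + B"
proof -
  \<comment> \<open>The sign \<open>s\<close> reflects the half-line from \<open>x\<close> away from
    the origin onto \<open>t \<ge> \<bar>x\<bar>\<close>; the powers \<open>s ^ i\<close> in
    \<open>g\<close> are the chain-rule factors.\<close>
  define s where "s = (if x \<ge> 0 then 1 else - 1 :: real)"
  have s: "\<bar>s\<bar> = 1" "s * s = 1" "s * \<bar>x\<bar> = x"
    by (auto simp: s_def)
  define g where "g i t = (\<bar>x\<bar> ^ a * s ^ i) *\<^sub>R nth_deriv i \<phi> (s * t)" for i t
  have norm_g: "norm (g i t) = \<bar>x\<bar> ^ a * norm (nth_deriv i \<phi> (s * t))" for i t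
    by (simp add: g_def s abs_mult power_abs)
  have "(g i has_vector_derivative g (Suc i) t) (at t)" for i t
  proof -
    have "((nth_deriv i \<phi> \<circ> (\<lambda>t. s * t)) has_vector_derivative s *\<^sub>R nth_deriv (Suc i) \<phi> (s * t)) (at t)"
      by (rule vector_diff_chain_at)
        (auto intro!: derivative_eq_intros smooth_has_vector_derivative \<open>smooth \<phi>\<close>
          simp flip: has_real_derivative_iff_has_vector_derivative)
    then show ?thesis
      unfolding g_def comp_def by (auto intro!: derivative_eq_intros simp: mult.assoc mult.commute)
  qed
  moreover have weight: "norm (g i t) \<le> \<bar>s * t\<bar> ^ a * norm (nth_deriv i \<phi> (s * t))"
    if "t \<ge> \<bar>x\<bar>" for i t
    unfolding norm_g using that by (intro mult_right_mono power_mono) (auto simp: abs_mult s)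
  moreover have "norm (g 0 t) \<le> A" if "t \<ge> \<bar>x\<bar>" for t
    using weight[OF that, of 0] A[of "s * t"] by (simp add: nth_deriv_def)
  moreover have "norm (g k t) \<le> B" if "t \<ge> \<bar>x\<bar>" for t
    using weight[OF that, of k] B[of "s * t"] by simp
  ultimately have "norm (g j \<bar>x\<bar>) \<le> real (k - j) * (2 * real k) ^ k * A + B"
    using \<open>j \<le> k\<close> by (intro intermediate_derivative_bound) auto
  also have "real (k - j) * (2 * real k) ^ k * A \<le> real k * (2 * real k) ^ k * A"
  proof -
    have "0 \<le> \<bar>0\<bar> ^ a * norm (\<phi> 0)"
      by simp
    then have "A \<ge> 0"
      using A[of 0] by linarith
    then show ?thesis
      by (intro mult_right_mono) auto
  qed
  finally show ?thesis
    by (simp add: norm_g s)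
qed

section \<open>Growth of the weight sequences and gaps between the given orders\<close>

lemma M_seq_ge_1: "\<tau> \<ge> 0 \<Longrightarrow> M_seq \<tau> \<sigma> n \<ge> 1"
  by (auto simp: M_seq_def intro!: ge_one_powr_ge_zero)

lemma M_seq_mono:
  assumes "0 \<le> \<tau>" "\<tau> \<le> \<tau>'" "0 \<le> \<sigma>" "n \<le> m"
  shows "M_seq \<tau> \<sigma> n \<le> M_seq \<tau>' \<sigma> m"
proof (cases "n = 0")
  case True
  then show ?thesis
    using M_seq_ge_1[of \<tau>' \<sigma> m] assms by (simp add: M_seq_def)
next
  case False
  have "real n powr (\<tau> * real n powr \<sigma>) \<le> real m powr (\<tau> * real n powr \<sigma>)"
    using assms by (intro powr_mono2) auto
  also have "\<dots> \<le> real m powr (\<tau>' * real m powr \<sigma>)"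
    using assms False by (intro powr_mono mult_mono powr_mono2) auto
  finally show ?thesis
    using False assms by (simp add: M_seq_def)
qed

text \<open>For \<open>m \<ge> 2\<close> the dilation is absorbed by \<open>r * m \<le> m powr (r + 1)\<close>; the constant is needed only
  for \<open>m = 1\<close>, where \<open>M_seq \<tau>' \<sigma> 1 = 1\<close> whatever \<open>\<tau>'\<close> is.\<close>

lemma M_seq_dilation:
  assumes "\<tau> > 0" "\<sigma> \<ge> 0" "r \<ge> 1"
  obtains \<tau>' D where "\<tau>' \<ge> \<tau>" "D \<ge> 1" "\<And>n m. n \<le> r * m \<Longrightarrow> M_seq \<tau> \<sigma> n \<le> D * M_seq \<tau>' \<sigma> m"
proof
  \<comment> \<open>The factor \<open>r + 1\<close> comes from the base \<open>r * m\<close>, the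
    factor \<open>r powr \<sigma>\<close> from the same product inside the exponent.\<close>
  let ?\<tau>' = "(real r + 1) * (\<tau> * real r powr \<sigma>)" and ?D = "M_seq \<tau> \<sigma> r"
  have r: "real r powr \<sigma> \<ge> 1"
    using assms by (intro ge_one_powr_ge_zero) auto
  have "1 * (\<tau> * 1) \<le> ?\<tau>'"
    using r assms by (intro mult_mono) auto
  then show \<tau>': "?\<tau>' \<ge> \<tau>"
    by simp
  show D: "?D \<ge> 1"
    using assms by (simp add: M_seq_ge_1)
  fix n m
  assume "n \<le> r * m"
  then have le: "M_seq \<tau> \<sigma> n \<le> M_seq \<tau> \<sigma> (r * m)"
    using assms by (intro M_seq_mono) auto
  consider "m = 0" | "m = 1" | "m \<ge> 2"
    by linarith
  then have "M_seq \<tau> \<sigma> (r * m) \<le> ?D * M_seq ?\<tau>' \<sigma> m"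
  proof cases
    case 3
    have "real r \<le> 2 ^ r"
      using of_nat_less_two_power[of r, where 'a = real] by linarith
    also have "\<dots> \<le> real m ^ r"
      using 3 by (intro power_mono) auto
    finally have "real (r * m) \<le> real m powr (real r + 1)"
      using 3 by (simp add: powr_add powr_realpow)
    then have "real (r * m) powr (\<tau> * real (r * m) powr \<sigma>)
        \<le> (real m powr (real r + 1)) powr (\<tau> * real (r * m) powr \<sigma>)"
      using assms by (intro powr_mono2) auto
    also have "\<dots> = real m powr (?\<tau>' * real m powr \<sigma>)"
      by (simp add: powr_powr powr_mult mult_ac)
    finally have "1 * M_seq \<tau> \<sigma> (r * m) \<le> ?D * M_seq ?\<tau>' \<sigma> m"
      using 3 assms D by (intro mult_mono) (auto simp: M_seq_def)
    then show ?thesis by simp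
  qed (use D in \<open>auto simp: M_seq_def\<close>)
  with le show "M_seq \<tau> \<sigma> n \<le> ?D * M_seq ?\<tau>' \<sigma> m"
    by linarith
qed

text \<open>Absorbs the interpolation cost by doubling the index: \<open>(2 * k) ^ (2 * k)\<close>
  is \<open>M_seq 1 1 (2 * k)\<close>.\<close>

lemma power_le_M_seq:
  assumes "\<tau> \<ge> 1" "\<sigma> \<ge> 1"
  shows "real k * (2 * real k) ^ k \<le> M_seq \<tau> \<sigma> (2 * k)"
proof (cases "k = 0")
  case False
  have "real k * (2 * real k) ^ k \<le> (2 * real k) ^ Suc k"
    by simp
  also have "\<dots> \<le> (2 * real k) ^ (2 * k)"
    using False by (intro power_increasing) auto
  also have "\<dots> = M_seq 1 1 (2 * k)"
    using False by (simp add: M_seq_def powr_realpow[symmetric] powr_mult)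
  also have "\<dots> \<le> M_seq \<tau> \<sigma> (2 * k)"
  proof -
    have k: "real (2 * k) \<ge> 1"
      using False by simp
    then have "1 * real (2 * k) powr 1 \<le> \<tau> * real (2 * k) powr \<sigma>"
      using assms by (intro mult_mono powr_mono) auto
    from powr_mono[OF this k] False show ?thesis
      by (simp only: M_seq_def mult_eq_0_iff) simp
  qed
  finally show ?thesis .
qed (simp add: M_seq_def)

text \<open>The predecessor of the first member \<open>f n \<ge> a\<close> lies below
  \<open>a\<close>, so the ratio bound gives \<open>f n \<le> L * a\<close>. From
  \<open>f 0 = 0\<close> to \<open>f 1\<close> no ratio is available, hence \<open>f 1\<close>
  enters the constant.\<close>

lemma strict_mono_ratio_cover:
  fixes f :: "nat \<Rightarrow> nat"
  assumes "strict_mono f" "f 0 = 0"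
    and ratio: "\<And>n. n \<ge> 1 \<Longrightarrow> real (f (n + 1)) / real (f n) \<le> L"
  shows "\<exists>R\<ge>1. \<forall>a. \<exists>n. a \<le> f n \<and> f n \<le> R * a"
proof (rule exI, intro conjI allI)
  let ?R = "max (nat \<lceil>L\<rceil>) (f 1)"
  show "?R \<ge> 1"
    using strict_monoD[OF \<open>strict_mono f\<close>, of 0 1] by simp
  fix a
  define n where "n = (LEAST n. a \<le> f n)"
  have "a \<le> f n"
    unfolding n_def by (rule LeastI[of _ a]) (rule strict_mono_imp_increasing[OF \<open>strict_mono f\<close>])
  moreover have "f n \<le> ?R * a"
  proof (cases n)
    case 0
    then show ?thesis using \<open>f 0 = 0\<close> by simp
  next
    case (Suc m)
    have less: "f m < a"
      using not_less_Least[of m "\<lambda>n. a \<le> f n"] Suc by (simp add: n_def)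
    show ?thesis
    proof (cases "m = 0")
      case True
      have "f 1 * 1 \<le> ?R * a"
        using less by (intro mult_le_mono) auto
      then show ?thesis using True Suc by simp
    next
      case False
      then have "f m > 0"
        using strict_monoD[OF \<open>strict_mono f\<close>, of 0 m] by simp
      then have "real (f n) \<le> L * real (f m)"
        using ratio[of m] False Suc by (simp add: divide_le_eq)
      also have "\<dots> \<le> real (nat \<lceil>L\<rceil>) * real (f m)"
        by (intro mult_right_mono real_nat_ceiling_ge) auto
      also have "\<dots> = real (nat \<lceil>L\<rceil> * f m)"
        by simp
      finally have "f n \<le> nat \<lceil>L\<rceil> * f m"
        by linarith
      also have "\<dots> \<le> ?R * a"
        using less by (intro mult_le_mono) auto
      finally show ?thesis .
    qed
  qed
  ultimately show "\<exists>n. a \<le> f n \<and> f n \<le> ?R * a"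
    by blast
qed

section \<open>Filling in the missing decay and derivative orders\<close>

theorem theorem4p3:
  fixes \<sigma> L \<tau>\<^sub>0 C\<^sub>0 :: real
    and \<alpha> \<beta> :: "nat \<Rightarrow> nat"
    and \<phi> :: "real \<Rightarrow> complex"
  assumes "\<sigma> > 1"
    and "strict_mono \<alpha>" and "strict_mono \<beta>"
    and "\<alpha> 0 = 0" and "\<beta> 0 = 0"
    and "L > 1"
    and "\<And>n. n \<ge> 1 \<Longrightarrow> real (\<alpha> (n + 1)) / real (\<alpha> n) \<le> L"
    and "\<And>n. n \<ge> 1 \<Longrightarrow> real (\<beta> (n + 1)) / real (\<beta> n) \<le> L"
    and "smooth \<phi>"
    and "\<tau>\<^sub>0 > 0" and "C\<^sub>0 > 0"
    and "\<And>m n. GS_seminorm \<phi> (\<alpha> n) (\<beta> m)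
           \<le> ereal (C\<^sub>0 * M_seq \<tau>\<^sub>0 \<sigma> (\<alpha> n) * M_seq \<tau>\<^sub>0 \<sigma> (\<beta> m))"
  shows "\<phi> \<in> GS_Roumieu \<sigma>"
proof -
  have "\<exists>R\<ge>1. \<forall>a. \<exists>n. a \<le> \<alpha> n \<and> \<alpha> n \<le> R * a"
    by (rule strict_mono_ratio_cover[of \<alpha> L]) (fact assms)+
  then obtain R\<^sub>1 where R1: "R\<^sub>1 \<ge> 1" "\<And>a. \<exists>n. a \<le> \<alpha> n \<and> \<alpha> n \<le> R\<^sub>1 * a"
    by blast
  have "\<exists>R\<ge>1. \<forall>b. \<exists>m. b \<le> \<beta> m \<and> \<beta> m \<le> R * b"
    by (rule strict_mono_ratio_cover[of \<beta> L]) (fact assms)+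
  then obtain R\<^sub>2 where R2: "R\<^sub>2 \<ge> 1" "\<And>b. \<exists>m. b \<le> \<beta> m \<and> \<beta> m \<le> R\<^sub>2 * b"
    by blast
  \<comment> \<open>Absorbing the interpolation cost by \<open>power_le_M_seq\<close> requires a
    parameter of at least 1.\<close>
  define \<tau>\<^sub>1 where "\<tau>\<^sub>1 = max 1 \<tau>\<^sub>0"
  have \<tau>1: "\<tau>\<^sub>1 \<ge> 1" "\<tau>\<^sub>1 \<ge> \<tau>\<^sub>0"
    by (auto simp: \<tau>\<^sub>1_def)
  \<comment> \<open>One dilation factor covers both \<open>\<alpha> n \<le> R\<^sub>1 * a\<close>
    and the doubled index \<open>2 * \<beta> m \<le> 2 * R\<^sub>2 * b\<close>, so a single
    \<open>\<tau>\<close> serves both variables.\<close>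
  obtain \<tau> D where \<tau>: "\<tau> \<ge> \<tau>\<^sub>1" and D: "D \<ge> 1"
    and dil: "\<And>n m. n \<le> (R\<^sub>1 + 2 * R\<^sub>2) * m \<Longrightarrow> M_seq \<tau>\<^sub>1 \<sigma> n \<le> D * M_seq \<tau> \<sigma> m"
    using M_seq_dilation[of \<tau>\<^sub>1 \<sigma> "R\<^sub>1 + 2 * R\<^sub>2"] \<tau>1 \<open>\<sigma> > 1\<close> R1(1) by auto
  have bound: "\<bar>x\<bar> ^ \<alpha> n * norm (nth_deriv (\<beta> m) \<phi> x) \<le> C\<^sub>0 * M_seq \<tau>\<^sub>0 \<sigma> (\<alpha> n) * M_seq \<tau>\<^sub>0 \<sigma> (\<beta> m)"
    for n m x
    using assms(12) by (simp add: GS_seminorm_le_iff)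
  have "GS_seminorm \<phi> a b \<le> ereal (4 * C\<^sub>0 * D * D * M_seq \<tau> \<sigma> a * M_seq \<tau> \<sigma> b)" for a b
    unfolding GS_seminorm_le_iff
  proof
    fix x
    obtain n where n: "a \<le> \<alpha> n" "\<alpha> n \<le> R\<^sub>1 * a"
      using R1(2) by blast
    obtain m where m: "b \<le> \<beta> m" "\<beta> m \<le> R\<^sub>2 * b"
      using R2(2) by blast
    let ?k = "\<beta> m"
    let ?P = "M_seq \<tau>\<^sub>0 \<sigma> (\<alpha> n)"
    have P: "?P \<ge> 1"
      using assms by (simp add: M_seq_ge_1)
    have weighted: "\<bar>y\<bar> ^ a * norm (nth_deriv (\<beta> m') \<phi> y) \<le> 2 * C\<^sub>0 * ?P * M_seq \<tau>\<^sub>0 \<sigma> (\<beta> m')" for m' y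
    proof -
      let ?Q = "M_seq \<tau>\<^sub>0 \<sigma> (\<beta> m')"
      have "\<bar>y\<bar> ^ a \<le> 1 + \<bar>y\<bar> ^ \<alpha> n"
      proof (cases "\<bar>y\<bar> \<le> 1")
        case True
        then have "\<bar>y\<bar> ^ a \<le> 1"
          by (simp add: power_le_one)
        then show ?thesis
          by (simp add: add_increasing2)
      next
        case False
        then have "\<bar>y\<bar> ^ a \<le> \<bar>y\<bar> ^ \<alpha> n"
          using n by (intro power_increasing) auto
        then show ?thesis by simp
      qed
      then have "\<bar>y\<bar> ^ a * norm (nth_deriv (\<beta> m') \<phi> y) \<le> (1 + \<bar>y\<bar> ^ \<alpha> n) * norm (nth_deriv (\<beta> m') \<phi> y)"
        by (intro mult_right_mono) auto
      \<comment> \<open>Since \<open>\<alpha> 0 = 0\<close>, the summand 1 is itself an admissible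
        weight, bounded by the hypothesis at index 0.\<close>
      also have "\<dots> \<le> C\<^sub>0 * 1 * ?Q + C\<^sub>0 * ?P * ?Q"
        using bound[of y 0 m'] bound[of y n m'] \<open>\<alpha> 0 = 0\<close> by (simp add: M_seq_def distrib_right)
      also have "\<dots> \<le> C\<^sub>0 * ?P * ?Q + C\<^sub>0 * ?P * ?Q"
        using P M_seq_ge_1[of \<tau>\<^sub>0 \<sigma> "\<beta> m'"] assms by (intro add_right_mono mult_mono) auto
      finally show ?thesis by simp
    qed
    \<comment> \<open>Order \<open>b\<close> is interpolated between \<open>\<beta> 0 = 0\<close>
      and \<open>\<beta> m \<ge> b\<close>, both of which \<open>weighted\<close> controls.\<close>
    have "\<bar>x\<bar> ^ a * norm (nth_deriv b \<phi> x)
        \<le> real ?k * (2 * real ?k) ^ ?k * (2 * C\<^sub>0 * ?P) + 2 * C\<^sub>0 * ?P * M_seq \<tau>\<^sub>0 \<sigma> ?k"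
    proof (rule weighted_intermediate_derivative_bound)
      show "\<bar>y\<bar> ^ a * norm (\<phi> y) \<le> 2 * C\<^sub>0 * ?P" for y
        using weighted[of y 0] \<open>\<beta> 0 = 0\<close> by (simp add: nth_deriv_def M_seq_def)
    qed (use assms weighted m in auto)
    also have "\<dots> = 2 * C\<^sub>0 * ?P * (real ?k * (2 * real ?k) ^ ?k + M_seq \<tau>\<^sub>0 \<sigma> ?k)"
      by (simp add: algebra_simps)
    \<comment> \<open>Both summands in the last factor are at most
      \<open>M_seq \<tau>\<^sub>1 \<sigma> (2 * ?k)\<close>, whence the second 2.\<close>
    also have "\<dots> \<le> 2 * C\<^sub>0 * (D * M_seq \<tau> \<sigma> a) * (2 * (D * M_seq \<tau> \<sigma> b))"
    proof (intro mult_mono)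
      have "?P \<le> M_seq \<tau>\<^sub>1 \<sigma> (\<alpha> n)"
        using \<tau>1 assms by (intro M_seq_mono) auto
      also have "\<dots> \<le> D * M_seq \<tau> \<sigma> a"
        using n(2) by (intro dil) (simp add: distrib_right)
      finally show "?P \<le> D * M_seq \<tau> \<sigma> a" .
      have "real ?k * (2 * real ?k) ^ ?k \<le> M_seq \<tau>\<^sub>1 \<sigma> (2 * ?k)"
        using \<tau>1 assms by (intro power_le_M_seq) auto
      moreover have "M_seq \<tau>\<^sub>0 \<sigma> ?k \<le> M_seq \<tau>\<^sub>1 \<sigma> (2 * ?k)"
        using \<tau>1 assms by (intro M_seq_mono) auto
      moreover have "M_seq \<tau>\<^sub>1 \<sigma> (2 * ?k) \<le> D * M_seq \<tau> \<sigma> b"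
        using m(2) by (intro dil) (simp add: distrib_right)
      ultimately show "real ?k * (2 * real ?k) ^ ?k + M_seq \<tau>\<^sub>0 \<sigma> ?k \<le> 2 * (D * M_seq \<tau> \<sigma> b)"
        by linarith
    qed (use assms D P \<tau> \<tau>1 M_seq_ge_1[of \<tau> \<sigma> a] M_seq_ge_1[of \<tau>\<^sub>0 \<sigma> ?k] in auto)
    finally show "\<bar>x\<bar> ^ a * norm (nth_deriv b \<phi> x) \<le> 4 * C\<^sub>0 * D * D * M_seq \<tau> \<sigma> a * M_seq \<tau> \<sigma> b"
      by (simp add: mult_ac)
  qed
  moreover have "4 * C\<^sub>0 * D * D > 0" "\<tau> > 0"
    using assms D \<tau> \<tau>1 by auto
  ultimately show ?thesis
    using \<open>smooth \<phi>\<close> unfolding GS_Roumieu_def by blast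
qed

end
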